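(* Let $k \geq 3$ be an integer and put $n = 2^{2k-1}$, $\alpha = 2^k-1$, $d_1 = 2^k+3$, $d_2 = 2^{k+1}-3$, $a_0 = 2^{k-1}-1$, $b_0 = 2^{k-1}$ and $s = 2^{k-1}-3$. In the dihedral group $D_n$ define $$A = \{b, b^2, \dots, b^{a_0}\} \cup \{ab, ab^2, \dots, ab^{a_0}\} \cup \{a\},$$ $$B = \{b^{\alpha}, b^{2\alpha}, \dots, b^{b_0\alpha}\} \cup \{ab^{\alpha}, ab^{2\alpha}, \dots, ab^{b_0\alpha}\} \cup \{e\},$$ $$A' = \{b^{-s}, b^{-s+d_1}, \dots, b^{-s+(a_0-1)d_1}\} \cup \{ab^{-s}, ab^{-s+d_1}, \dots, ab^{-s+(a_0-1)d_1}\} \cup \{a\},$$ $$B' = \{b^{-s+d_2}, b^{-s+2d_2}, \dots, b^{-s+b_0d_2}\} \cup \{ab^{-s+d_2}, ab^{-s+2d_2}, \dots, ab^{-s+b_0d_2}\} \cup \{e\}.$$ Then the two near-factorizations $(A,B)$ and $(A',B')$ of $D_n$ are equivalent. Specifically, $\Phi_{f_{-d_1,0},\,e}\big((A,B)\big) = (A',B')$.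
   Context: For $n>2$, $D_n = \langle a,b : a^2 = b^n = abab = e\rangle$ is the dihedral group of order $2n$, with identity $e$ and elements $a^ib^j$, $i\in\{0,1\}$, $0\le j\le n-1$ (exponents of $b$ are taken modulo $n$). For subsets $X,Y$ of a group $G$, $XY=\{xy : x\in X, y\in Y\}$. A pair $(A,B)$ of subsets of a finite group $G$ with identity $e$ is a near-factorization of $G$ if $|A|\cdot|B| = |G|-1$ and $AB = G\setminus\{e\}$. It is known from the literature that the pairs $(A,B)$ and $(A',B')$ in the claim are near-factorizations of $D_n$. For $f\in \mathrm{Aut}(G)$ and $h\in G$, $\Phi_{f,h}(A,B) = (f(A)h,\, h^{-1}f(B))$, and two near-factorizations are equivalent if one is the image of the other under some $\Phi_{f,h}$. For integers $i,j$ with $\gcd(i,n)=1$ (taken modulo $n$), $f_{i,j}$ denotes the automorphism of $D_n$ with $f_{i,j}(a)=ab^j$ and $f_{i,j}(b)=b^i$. *)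

theory Defs
  imports "HOL-Algebra.Algebra"
begin

text \<open>
  The dihedral group of order \<open>2n\<close> in normal form: the pair \<open>(i, j)\<close> with \<open>0 \<le> i < 2\<close> and
  \<open>0 \<le> j < n\<close> stands for \<open>a\<^sup>i b\<^sup>j\<close>, and the product is forced by \<open>b a = a b\<^sup>-\<^sup>1\<close>. The lemmas
  \<open>dih_relations\<close>, \<open>dih_generate\<close>, \<open>dih_universal\<close> and \<open>dih_order\<close> show that this is the group
  presented by \<open>\<langle>a, b : a\<^sup>2 = b\<^sup>n = abab = e\<rangle>\<close> and that it has order \<open>2n\<close>.
\<close>

definition dihedral :: "nat \<Rightarrow> (int \<times> int) monoid" where
  "dihedral n =
    \<lparr>carrier = {0..<2} \<times> {0..<int n},
     monoid.mult = (\<lambda>(i, j) (i', j'). ((i + i') mod 2, ((if i' = 0 then j else - j) + j') mod int n)),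
     one = (0, 0)\<rparr>"

definition dih_a :: "int \<times> int" where "dih_a = (1, 0)"

definition dih_b :: "int \<times> int" where "dih_b = (0, 1)"

text \<open>
  \<^const>\<open>auto\<close> consists of extensional functions, so for \<open>n > 2\<close> and \<open>i\<close> coprime to \<open>n\<close> exactly
  one function satisfies the description below (lemma \<open>dih_aut\<close>).
\<close>

definition dih_aut :: "nat \<Rightarrow> int \<Rightarrow> int \<Rightarrow> int \<times> int \<Rightarrow> int \<times> int" where
  "dih_aut n i j = (THE f. f \<in> auto (dihedral n) \<and>
     f dih_a = dih_a \<otimes>\<^bsub>dihedral n\<^esub> (dih_b [^]\<^bsub>dihedral n\<^esub> j) \<and>
     f dih_b = dih_b [^]\<^bsub>dihedral n\<^esub> i)"

definition near_factorization :: "('a, 'm) monoid_scheme \<Rightarrow> 'a set \<times> 'a set \<Rightarrow> bool" where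
  "near_factorization G = (\<lambda>(A, B). group G \<and> finite (carrier G) \<and>
     A \<subseteq> carrier G \<and> B \<subseteq> carrier G \<and>
     card A * card B = order G - 1 \<and> A <#>\<^bsub>G\<^esub> B = carrier G - {\<one>\<^bsub>G\<^esub>})"

definition nf_map ::
    "('a, 'm) monoid_scheme \<Rightarrow> ('a \<Rightarrow> 'a) \<Rightarrow> 'a \<Rightarrow> 'a set \<times> 'a set \<Rightarrow> 'a set \<times> 'a set" where
  "nf_map G f h = (\<lambda>(A, B). (f ` A #>\<^bsub>G\<^esub> h, (inv\<^bsub>G\<^esub> h) <#\<^bsub>G\<^esub> (f ` B)))"

definition nf_equivalent ::
    "('a, 'm) monoid_scheme \<Rightarrow> 'a set \<times> 'a set \<Rightarrow> 'a set \<times> 'a set \<Rightarrow> bool" where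
  "nf_equivalent G P Q \<longleftrightarrow> near_factorization G P \<and> near_factorization G Q \<and>
     (\<exists>f\<in>auto G. \<exists>h\<in>carrier G. nf_map G f h P = Q)"

lemma dih_carrier [simp]: "carrier (dihedral n) = {0..<2} \<times> {0..<int n}"
  by (simp add: dihedral_def)

lemma dih_one [simp]: "\<one>\<^bsub>dihedral n\<^esub> = (0, 0)"
  by (simp add: dihedral_def)

lemma dih_mult [simp]:
  "(i, j) \<otimes>\<^bsub>dihedral n\<^esub> (i', j') =
     ((i + i') mod 2, ((if i' = 0 then j else - j) + j') mod int n)"
  by (simp add: dihedral_def)

lemma zero_one_cases: "(i::int) \<in> {0..<2} \<longleftrightarrow> i = 0 \<or> i = 1"
  by auto

lemma dih_group:
  assumes "n > 0"
  shows "group (dihedral n)"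
proof (rule groupI)
  fix x y assume "x \<in> carrier (dihedral n)" "y \<in> carrier (dihedral n)"
  then show "x \<otimes>\<^bsub>dihedral n\<^esub> y \<in> carrier (dihedral n)"
    using assms by (cases x; cases y) auto
next
  show "\<one>\<^bsub>dihedral n\<^esub> \<in> carrier (dihedral n)"
    using assms by simp
next
  fix x y z
  assume "x \<in> carrier (dihedral n)" "y \<in> carrier (dihedral n)" "z \<in> carrier (dihedral n)"
  then show "x \<otimes>\<^bsub>dihedral n\<^esub> y \<otimes>\<^bsub>dihedral n\<^esub> z = x \<otimes>\<^bsub>dihedral n\<^esub> (y \<otimes>\<^bsub>dihedral n\<^esub> z)"
    by (cases x; cases y; cases z)
      (auto simp: zero_one_cases mod_simps algebra_simps simp del: atLeastLessThan_iff)
next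
  fix x assume "x \<in> carrier (dihedral n)"
  then show "\<one>\<^bsub>dihedral n\<^esub> \<otimes>\<^bsub>dihedral n\<^esub> x = x"
    by (cases x) auto
next
  fix x assume x: "x \<in> carrier (dihedral n)"
  obtain i j where ij: "x = (i, j)" by (cases x)
  show "\<exists>y\<in>carrier (dihedral n). y \<otimes>\<^bsub>dihedral n\<^esub> x = \<one>\<^bsub>dihedral n\<^esub>"
  proof (cases "i = 0")
    case True
    then show ?thesis using assms x ij
      by (intro bexI[of _ "(0, (- j) mod int n)"]) (auto simp: mod_simps)
  next
    case False
    then have "i = 1" using x ij by auto
    then show ?thesis using assms x ij
      by (intro bexI[of _ "(1, j)"]) (auto simp: mod_simps)
  qed
qed

lemma dih_mem:
  assumes "n > 2"
  shows "dih_a \<in> carrier (dihedral n)" "dih_b \<in> carrier (dihedral n)"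
  using assms by (auto simp: dih_a_def dih_b_def)

lemma dih_b_nat_pow:
  assumes "n > 2"
  shows "dih_b [^]\<^bsub>dihedral n\<^esub> (m::nat) = (0, int m mod int n)"
proof -
  interpret group "dihedral n" using assms by (simp add: dih_group)
  show ?thesis
    by (induction m) (auto simp: dih_b_def mod_simps algebra_simps)
qed

lemma dih_b_pow:
  assumes "n > 2"
  shows "dih_b [^]\<^bsub>dihedral n\<^esub> (m::int) = (0, m mod int n)"
proof -
  interpret group "dihedral n" using assms by (simp add: dih_group)
  consider k where "m = int k" | k where "m = - int k"
    using int_cases2 by blast
  then show ?thesis
  proof cases
    case 1
    then show ?thesis using dih_b_nat_pow[OF assms, of k] by (simp only: int_pow_int)
  next
    case 2
    have "(- int k mod int n + int k mod int n) mod int n = (- int k + int k) mod int n"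
      by (rule mod_add_eq)
    then have "inv\<^bsub>dihedral n\<^esub> (0, int k mod int n) = (0, - int k mod int n)"
      using assms by (intro inv_equality) auto
    moreover have "dih_b \<in> carrier (dihedral n)"
      using assms by (auto simp: dih_b_def)
    ultimately show ?thesis using 2 dih_b_nat_pow[OF assms, of k]
      by (simp only: int_pow_neg int_pow_int)
  qed
qed

lemma dih_normal_form:
  assumes "n > 2"
  shows "dih_a \<otimes>\<^bsub>dihedral n\<^esub> (dih_b [^]\<^bsub>dihedral n\<^esub> (m::int)) = (1, m mod int n)"
  using assms by (simp add: dih_b_pow dih_a_def mod_simps)

lemma dih_relations:
  assumes "n > 2"
  shows "dih_a \<otimes>\<^bsub>dihedral n\<^esub> dih_a = \<one>\<^bsub>dihedral n\<^esub>"
    and "dih_b [^]\<^bsub>dihedral n\<^esub> n = \<one>\<^bsub>dihedral n\<^esub>"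
    and "dih_a \<otimes>\<^bsub>dihedral n\<^esub> dih_b \<otimes>\<^bsub>dihedral n\<^esub> dih_a \<otimes>\<^bsub>dihedral n\<^esub> dih_b = \<one>\<^bsub>dihedral n\<^esub>"
  using assms by (simp_all add: dih_b_nat_pow) (simp_all add: dih_a_def dih_b_def mod_simps)

lemma dih_order: "order (dihedral n) = 2 * n"
  by (simp add: order_def)

lemma dih_eq_word:
  assumes "n > 2" "(i, j) \<in> carrier (dihedral n)"
  shows "(i, j) = dih_a [^]\<^bsub>dihedral n\<^esub> nat i \<otimes>\<^bsub>dihedral n\<^esub> dih_b [^]\<^bsub>dihedral n\<^esub> nat j"
proof -
  interpret group "dihedral n" using assms by (simp add: dih_group)
  have b: "dih_b [^]\<^bsub>dihedral n\<^esub> nat j = (0, j)"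
    using assms by (simp only: dih_b_nat_pow) simp
  have "i = 0 \<or> i = 1" using assms by auto
  then have "dih_a [^]\<^bsub>dihedral n\<^esub> nat i = (i, 0)"
    using nat_pow_eone[OF dih_mem(1)[OF assms(1)]] by (auto simp: dih_a_def)
  then show ?thesis unfolding b using assms by simp
qed

lemma dih_generate:
  assumes "n > 2"
  shows "generate (dihedral n) {dih_a, dih_b} = carrier (dihedral n)"
proof
  interpret group "dihedral n" using assms by (simp add: dih_group)
  show "generate (dihedral n) {dih_a, dih_b} \<subseteq> carrier (dihedral n)"
    using dih_mem[OF assms] by (intro generate_incl) auto
  have sub: "subgroup (generate (dihedral n) {dih_a, dih_b}) (dihedral n)"
    using dih_mem[OF assms] by (intro generate_is_subgroup) auto
  have pow: "x [^]\<^bsub>dihedral n\<^esub> (m::nat) \<in> generate (dihedral n) {dih_a, dih_b}"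
    if "x \<in> {dih_a, dih_b}" for x m
  proof (induction m)
    case 0
    then show ?case using generate.one[of "dihedral n"] by simp
  next
    case (Suc m)
    then show ?case
      using generate.eng[OF Suc generate.incl[OF that]] by simp
  qed
  show "carrier (dihedral n) \<subseteq> generate (dihedral n) {dih_a, dih_b}"
  proof
    fix x assume x: "x \<in> carrier (dihedral n)"
    obtain i j where "x = (i, j)" by (cases x)
    then show "x \<in> generate (dihedral n) {dih_a, dih_b}"
      using dih_eq_word[OF assms, of i j] x pow[of dih_a "nat i"] pow[of dih_b "nat j"]
        generate.eng by (metis insertCI)
  qed
qed

lemma dih_universal:
  assumes n: "n > 2" and H: "group H" and xy: "x \<in> carrier H" "y \<in> carrier H"
    and rel: "x \<otimes>\<^bsub>H\<^esub> x = \<one>\<^bsub>H\<^esub>" "y [^]\<^bsub>H\<^esub> n = \<one>\<^bsub>H\<^esub>"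
      "x \<otimes>\<^bsub>H\<^esub> y \<otimes>\<^bsub>H\<^esub> x \<otimes>\<^bsub>H\<^esub> y = \<one>\<^bsub>H\<^esub>"
  shows "\<exists>h\<in>hom (dihedral n) H. h dih_a = x \<and> h dih_b = y"
proof -
  interpret H: group H by (rule H)
  note cl [simp] = xy
  have mod: "y [^]\<^bsub>H\<^esub> (m mod int n) = y [^]\<^bsub>H\<^esub> m" for m :: int
  proof -
    have "y [^]\<^bsub>H\<^esub> m = y [^]\<^bsub>H\<^esub> (int n * (m div int n) + m mod int n)" by simp
    also have "\<dots> = (y [^]\<^bsub>H\<^esub> int n) [^]\<^bsub>H\<^esub> (m div int n) \<otimes>\<^bsub>H\<^esub> y [^]\<^bsub>H\<^esub> (m mod int n)"
      unfolding H.int_pow_mult[OF xy(2)] H.int_pow_pow[OF xy(2)] ..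
    also have "\<dots> = y [^]\<^bsub>H\<^esub> (m mod int n)"
      using rel(2) by (simp add: int_pow_int)
    finally show ?thesis ..
  qed
  have invx: "inv\<^bsub>H\<^esub> x = x" using rel(1) by (simp add: H.inv_equality)
  have conj1: "x \<otimes>\<^bsub>H\<^esub> y \<otimes>\<^bsub>H\<^esub> x = inv\<^bsub>H\<^esub> y"
    using rel(3) by (simp add: H.inv_equality)
  have conj_nat: "x \<otimes>\<^bsub>H\<^esub> y [^]\<^bsub>H\<^esub> (m::nat) \<otimes>\<^bsub>H\<^esub> x = inv\<^bsub>H\<^esub> (y [^]\<^bsub>H\<^esub> m)" for m
  proof (induction m)
    case 0
    then show ?case using rel(1) by simp
  next
    case (Suc m)
    have xx: "x \<otimes>\<^bsub>H\<^esub> (x \<otimes>\<^bsub>H\<^esub> z) = z" if "z \<in> carrier H" for z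
      using that rel(1) by (simp add: H.m_assoc[symmetric])
    have "x \<otimes>\<^bsub>H\<^esub> y [^]\<^bsub>H\<^esub> (Suc m) \<otimes>\<^bsub>H\<^esub> x
        = (x \<otimes>\<^bsub>H\<^esub> y \<otimes>\<^bsub>H\<^esub> x) \<otimes>\<^bsub>H\<^esub> (x \<otimes>\<^bsub>H\<^esub> y [^]\<^bsub>H\<^esub> m \<otimes>\<^bsub>H\<^esub> x)"
      using H.nat_pow_Suc2[OF xy(2), of m] by (simp add: H.m_assoc xx del: H.nat_pow_Suc)
    also have "\<dots> = inv\<^bsub>H\<^esub> (y [^]\<^bsub>H\<^esub> Suc m)"
      by (simp add: Suc conj1 H.inv_mult_group)
    finally show ?case .
  qed
  have conj_int: "x \<otimes>\<^bsub>H\<^esub> y [^]\<^bsub>H\<^esub> (m::int) = y [^]\<^bsub>H\<^esub> (- m) \<otimes>\<^bsub>H\<^esub> x" for m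
  proof -
    have nat: "x \<otimes>\<^bsub>H\<^esub> y [^]\<^bsub>H\<^esub> int m = y [^]\<^bsub>H\<^esub> (- int m) \<otimes>\<^bsub>H\<^esub> x" for m :: nat
    proof -
      have "x \<otimes>\<^bsub>H\<^esub> y [^]\<^bsub>H\<^esub> int m = x \<otimes>\<^bsub>H\<^esub> y [^]\<^bsub>H\<^esub> m \<otimes>\<^bsub>H\<^esub> x \<otimes>\<^bsub>H\<^esub> x"
        using rel(1) by (simp add: int_pow_int H.m_assoc)
      also have "\<dots> = y [^]\<^bsub>H\<^esub> (- int m) \<otimes>\<^bsub>H\<^esub> x"
        by (simp add: conj_nat H.int_pow_neg int_pow_int)
      finally show ?thesis .
    qed
    show ?thesis
    proof (cases "m \<ge> 0")
      case True
      then show ?thesis using nat[of "nat m"] by simp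
    next
      case False
      have "x \<otimes>\<^bsub>H\<^esub> (x \<otimes>\<^bsub>H\<^esub> y [^]\<^bsub>H\<^esub> (- m)) \<otimes>\<^bsub>H\<^esub> x = x \<otimes>\<^bsub>H\<^esub> (y [^]\<^bsub>H\<^esub> m \<otimes>\<^bsub>H\<^esub> x) \<otimes>\<^bsub>H\<^esub> x"
        using False nat[of "nat (- m)"] by simp
      moreover have "x \<otimes>\<^bsub>H\<^esub> (x \<otimes>\<^bsub>H\<^esub> y [^]\<^bsub>H\<^esub> (- m)) \<otimes>\<^bsub>H\<^esub> x = y [^]\<^bsub>H\<^esub> (- m) \<otimes>\<^bsub>H\<^esub> x"
        using rel(1) by (simp add: H.m_assoc[symmetric])
      moreover have "x \<otimes>\<^bsub>H\<^esub> (y [^]\<^bsub>H\<^esub> m \<otimes>\<^bsub>H\<^esub> x) \<otimes>\<^bsub>H\<^esub> x = x \<otimes>\<^bsub>H\<^esub> y [^]\<^bsub>H\<^esub> m"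
        using rel(1) by (simp add: H.m_assoc)
      ultimately show ?thesis by simp
    qed
  qed
  define h where "h = (\<lambda>(i::int, j::int). (if i = 0 then \<one>\<^bsub>H\<^esub> else x) \<otimes>\<^bsub>H\<^esub> y [^]\<^bsub>H\<^esub> j)"
  have "h \<in> hom (dihedral n) H"
  proof (rule homI)
    fix u assume "u \<in> carrier (dihedral n)"
    then show "h u \<in> carrier H" by (auto simp: h_def)
  next
    fix u v assume uv: "u \<in> carrier (dihedral n)" "v \<in> carrier (dihedral n)"
    obtain i j i' j' where e: "u = (i, j)" "v = (i', j')" by (cases u; cases v)
    have 01: "i = 0 \<or> i = 1" "i' = 0 \<or> i' = 1" using uv e by auto
    have tr: "y [^]\<^bsub>H\<^esub> j \<otimes>\<^bsub>H\<^esub> (x \<otimes>\<^bsub>H\<^esub> y [^]\<^bsub>H\<^esub> j') = x \<otimes>\<^bsub>H\<^esub> y [^]\<^bsub>H\<^esub> (- j + j')"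
      using conj_int[of "- j"] H.int_pow_mult[OF xy(2), of "- j" j']
      by (simp add: H.m_assoc[symmetric])
    have xx: "x \<otimes>\<^bsub>H\<^esub> (x \<otimes>\<^bsub>H\<^esub> z) = z" if "z \<in> carrier H" for z
      using that rel(1) by (simp add: H.m_assoc[symmetric])
    show "h (u \<otimes>\<^bsub>dihedral n\<^esub> v) = h u \<otimes>\<^bsub>H\<^esub> h v"
      using 01 unfolding e
      by (auto simp: h_def mod tr xx H.m_assoc H.int_pow_mult simp del: uminus_add_conv_diff)
  qed
  moreover have "h dih_a = x" "h dih_b = y"
    by (simp_all add: h_def dih_a_def dih_b_def H.int_pow_1)
  ultimately show ?thesis by blast
qed

lemma dih_hom_unique:
  assumes n: "n > 2" and H: "group H"
    and f: "f \<in> hom (dihedral n) H" and g: "g \<in> hom (dihedral n) H"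
    and eq: "f dih_a = g dih_a" "f dih_b = g dih_b"
    and x: "x \<in> carrier (dihedral n)"
  shows "f x = g x"
proof -
  interpret D: group "dihedral n" using n by (simp add: dih_group)
  interpret f: group_hom "dihedral n" H f
    using H f by (intro group_hom.intro) (auto intro: D.group_axioms simp: group_hom_axioms_def)
  interpret g: group_hom "dihedral n" H g
    using H g by (intro group_hom.intro) (auto intro: D.group_axioms simp: group_hom_axioms_def)
  obtain i j where ij: "x = (i, j)" by (cases x)
  show ?thesis
    unfolding ij using dih_eq_word[OF n, of i j] x ij dih_mem[OF n] eq
    by (metis D.nat_pow_closed f.hom_mult f.hom_nat_pow g.hom_mult g.hom_nat_pow)
qed

lemma dih_aut_ex1:
  fixes i j :: int
  assumes n: "n > 2" and cop: "coprime i (int n)"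
  shows "\<exists>!f. f \<in> auto (dihedral n) \<and>
     f dih_a = dih_a \<otimes>\<^bsub>dihedral n\<^esub> (dih_b [^]\<^bsub>dihedral n\<^esub> j) \<and>
     f dih_b = dih_b [^]\<^bsub>dihedral n\<^esub> i"
proof (rule ex_ex1I)
  define f where "f = (\<lambda>x\<in>carrier (dihedral n). (fst x, (i * snd x + j * fst x) mod int n))"
  have app: "f (u, v) = (u, (i * v + j * u) mod int n)" if "(u, v) \<in> carrier (dihedral n)" for u v
    using that by (simp add: f_def)
  have lin: "(c + i * (t mod int n)) mod int n = (c + i * t) mod int n" for c t
    by (metis mod_add_right_eq mod_mult_right_eq)
  have hom: "f \<in> hom (dihedral n) (dihedral n)"
  proof (rule homI)
    fix x assume "x \<in> carrier (dihedral n)"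
    then show "f x \<in> carrier (dihedral n)" using n by (cases x) (auto simp: app)
  next
    fix x y assume xy: "x \<in> carrier (dihedral n)" "y \<in> carrier (dihedral n)"
    obtain u v u' v' where e: "x = (u, v)" "y = (u', v')" by (cases x; cases y)
    have "x \<otimes>\<^bsub>dihedral n\<^esub> y \<in> carrier (dihedral n)" using xy n by (simp add: e)
    moreover have "u = 0 \<or> u = 1" "u' = 0 \<or> u' = 1" using xy e by auto
    ultimately show "f (x \<otimes>\<^bsub>dihedral n\<^esub> y) = f x \<otimes>\<^bsub>dihedral n\<^esub> f y"
      using xy unfolding e by (auto simp: app lin mod_simps algebra_simps)
  qed
  have inj: "inj_on f (carrier (dihedral n))"
  proof (rule inj_onI)
    fix x y assume xy: "x \<in> carrier (dihedral n)" "y \<in> carrier (dihedral n)" "f x = f y"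
    obtain u v u' v' where e: "x = (u, v)" "y = (u', v')" by (cases x; cases y)
    have u: "u = u'" and "(i * v + j * u) mod int n = (i * v' + j * u) mod int n"
      using xy e by (auto simp: app)
    then have "int n dvd i * (v - v')"
      by (simp add: mod_eq_dvd_iff algebra_simps)
    then have "int n dvd v - v'"
      using cop by (simp add: coprime_commute coprime_dvd_mult_right_iff)
    then have "v mod int n = v' mod int n" by (simp add: mod_eq_dvd_iff)
    then show "x = y" using xy e u by simp
  qed
  have "f ` carrier (dihedral n) = carrier (dihedral n)"
  proof (rule endo_inj_surj[OF _ _ inj])
    show "finite (carrier (dihedral n))" by simp
    show "f ` carrier (dihedral n) \<subseteq> carrier (dihedral n)"
      by (intro image_subsetI hom_in_carrier[OF hom])
  qed
  then have "bij_betw f (carrier (dihedral n)) (carrier (dihedral n))"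
    using inj by (simp only: bij_betw_def)
  moreover have "f \<in> extensional (carrier (dihedral n))"
    unfolding f_def by (rule restrict_extensional)
  ultimately have "f \<in> auto (dihedral n)"
    using hom unfolding auto_def Bij_def by blast
  moreover have "f dih_a = dih_a \<otimes>\<^bsub>dihedral n\<^esub> (dih_b [^]\<^bsub>dihedral n\<^esub> j)"
    using n by (simp add: dih_normal_form) (simp add: dih_a_def app)
  moreover have "f dih_b = dih_b [^]\<^bsub>dihedral n\<^esub> i"
    using n by (simp add: dih_b_pow) (simp add: dih_b_def app)
  ultimately show "\<exists>f. f \<in> auto (dihedral n) \<and>
     f dih_a = dih_a \<otimes>\<^bsub>dihedral n\<^esub> (dih_b [^]\<^bsub>dihedral n\<^esub> j) \<and>
     f dih_b = dih_b [^]\<^bsub>dihedral n\<^esub> i" by blast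
next
  fix f g
  assume f: "f \<in> auto (dihedral n) \<and>
     f dih_a = dih_a \<otimes>\<^bsub>dihedral n\<^esub> (dih_b [^]\<^bsub>dihedral n\<^esub> j) \<and>
     f dih_b = dih_b [^]\<^bsub>dihedral n\<^esub> i"
   and g: "g \<in> auto (dihedral n) \<and>
     g dih_a = dih_a \<otimes>\<^bsub>dihedral n\<^esub> (dih_b [^]\<^bsub>dihedral n\<^esub> j) \<and>
     g dih_b = dih_b [^]\<^bsub>dihedral n\<^esub> i"
  have "group (dihedral n)" using n by (simp add: dih_group)
  then have "f x = g x" if "x \<in> carrier (dihedral n)" for x
    using dih_hom_unique[OF n, of "dihedral n" f g x] f g that unfolding auto_def by auto
  moreover have "f \<in> extensional (carrier (dihedral n))" "g \<in> extensional (carrier (dihedral n))"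
    using f g unfolding auto_def Bij_def by blast+
  ultimately show "f = g" by (intro extensionalityI)
qed

lemma dih_aut:
  fixes i j :: int
  assumes "n > 2" "coprime i (int n)"
  shows "dih_aut n i j \<in> auto (dihedral n)"
    and "dih_aut n i j dih_a = dih_a \<otimes>\<^bsub>dihedral n\<^esub> (dih_b [^]\<^bsub>dihedral n\<^esub> j)"
    and "dih_aut n i j dih_b = dih_b [^]\<^bsub>dihedral n\<^esub> i"
  using theI'[OF dih_aut_ex1[OF assms, of j]] unfolding dih_aut_def by blast+

end

theory Submission
  imports Defs
begin

text \<open>
  Put \<open>m = 2\<^sup>k\<^sup>-\<^sup>1\<close>, so that \<open>n = 2m\<^sup>2\<close>, \<open>\<alpha> = 2m - 1\<close>, \<open>d\<^sub>1 = 2m + 3\<close>, \<open>d\<^sub>2 = 4m - 3\<close> and \<open>s = m - 3\<close>.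
  Since \<open>(m - 1) d\<^sub>1 \<equiv> s\<close>, \<open>\<alpha> d\<^sub>1 \<equiv> d\<^sub>2\<close> and \<open>(m + 1) d\<^sub>2 \<equiv> s\<close> modulo \<open>n\<close>, multiplying the exponents
  by \<open>-d\<^sub>1\<close> turns the progressions of \<open>(A, B)\<close> into those of \<open>(A', B')\<close>, run through backwards.
  The exponents occurring in \<open>A B\<close> are the integers \<open>j\<alpha> + i\<close> with \<open>\<bar>i\<bar> < m\<close>, \<open>1 \<le> j \<le> m\<close>, which tile
  the interval from \<open>m\<close> to \<open>n - 1\<close>, and those below \<open>m\<close>, where \<open>0\<close> occurs only for the reflection
  \<open>a\<close>; thus \<open>(A, B)\<close> is a near-factorization, and automorphisms preserve this.
\<close>

section \<open>Invariance of near-factorizations under automorphisms and translations\<close>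

text \<open>In every product of an element of \<open>f(A) h\<close> with one of
  \<open>h^-1 f(B)\<close> the inner \<open>h\<close> cancels, so the product set is
  \<open>f(AB)\<close>; \<open>f\<close> is bijective and fixes the identity, and translations keep
  cardinalities.\<close>

lemma near_factorization_nf_map:
  assumes nf: "near_factorization G (A, B)" and f: "f \<in> auto G" and h: "h \<in> carrier G"
  shows "near_factorization G (nf_map G f h (A, B))"
proof -
  from nf have G: "group G" "finite (carrier G)" and sub: "A \<subseteq> carrier G" "B \<subseteq> carrier G"
    and card: "card A * card B = order G - 1" and AB: "A <#>\<^bsub>G\<^esub> B = carrier G - {\<one>\<^bsub>G\<^esub>}"
    by (auto simp: near_factorization_def)
  interpret group G by (rule G)
  interpret f: group_hom G G f
    using f by unfold_locales (auto simp: auto_def)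
  have bij: "bij_betw f (carrier G) (carrier G)"
    using f by (auto simp: auto_def Bij_def)
  then have inj: "inj_on f (carrier G)" and surj: "f ` carrier G = carrier G"
    by (auto simp: bij_betw_def)
  have fA: "f ` A \<subseteq> carrier G" and fB: "f ` B \<subseteq> carrier G"
    using sub by (auto intro: f.hom_closed)
  let ?A = "f ` A #>\<^bsub>G\<^esub> h" and ?B = "(inv\<^bsub>G\<^esub> h) <#\<^bsub>G\<^esub> (f ` B)"
  \<comment> \<open>\<open>card_cosets_equal\<close> asks only for a subset of the carrier, so it
    applies to translates of \<open>f(A)\<close>, which need not be a subgroup.\<close>
  have "card ?A = card (f ` A)"
    using card_cosets_equal[OF rcosetsI[OF fA h] fA] by (auto dest: bij_betw_same_card)
  moreover have "?B = (\<lambda>x. inv\<^bsub>G\<^esub> h \<otimes>\<^bsub>G\<^esub> x) ` f ` B"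
    by (auto simp: l_coset_def)
  then have "card ?B = card (f ` B)"
    using h fB by (auto intro!: card_image inj_onI simp: image_subset_iff)
  moreover have "card (f ` A) = card A" "card (f ` B) = card B"
    using inj sub by (auto intro!: card_image intro: inj_on_subset)
  moreover have "?A <#>\<^bsub>G\<^esub> ?B = f ` (A <#>\<^bsub>G\<^esub> B)"
  proof -
    have "x \<otimes>\<^bsub>G\<^esub> h \<otimes>\<^bsub>G\<^esub> (inv\<^bsub>G\<^esub> h \<otimes>\<^bsub>G\<^esub> y) = x \<otimes>\<^bsub>G\<^esub> y" if "x \<in> carrier G" "y \<in> carrier G" for x y
      using that h by (metis inv_closed inv_solve_left m_assoc m_closed)
    then have "f x \<otimes>\<^bsub>G\<^esub> h \<otimes>\<^bsub>G\<^esub> (inv\<^bsub>G\<^esub> h \<otimes>\<^bsub>G\<^esub> f y) = f (x \<otimes>\<^bsub>G\<^esub> y)" if "x \<in> A" "y \<in> B" for x y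
      using that sub by (simp add: subset_iff)
    then show ?thesis
      by (force simp: set_mult_def r_coset_def l_coset_def image_UN)
  qed
  moreover have "f ` (carrier G - {\<one>\<^bsub>G\<^esub>}) = carrier G - {\<one>\<^bsub>G\<^esub>}"
    using inj_on_image_set_diff[OF inj, of "carrier G" "{\<one>\<^bsub>G\<^esub>}"] surj by simp
  ultimately show ?thesis
    using G card AB r_coset_subset_G[OF fA h] l_coset_subset_G[OF fB inv_closed[OF h]]
    by (simp add: near_factorization_def nf_map_def)
qed

lemma nf_map_one:
  assumes "group G" "f ` A \<subseteq> carrier G" "f ` B \<subseteq> carrier G"
  shows "nf_map G f \<one>\<^bsub>G\<^esub> (A, B) = (f ` A, f ` B)"
proof -
  interpret group G by (rule assms)
  show ?thesis
    using assms by (simp add: nf_map_def lcos_mult_one)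
qed

section \<open>Automorphisms of the dihedral group in coordinates\<close>

text \<open>The two prescribed values on the generators extend along powers of \<open>dih_b\<close>.
  Exponents are kept as residues of arbitrary integers, so negative or large exponents need no prior
  reduction.\<close>

lemma dih_aut_apply:
  fixes i j v :: int
  assumes n: "n > 2" and cop: "coprime i (int n)"
  shows "dih_aut n i j (0, v mod int n) = (0, i * v mod int n)"
    and "dih_aut n i j (1, v mod int n) = (1, (j + i * v) mod int n)"
proof -
  let ?D = "dihedral n" and ?f = "dih_aut n i j"
  interpret group ?D using n by (simp add: dih_group)
  note f = dih_aut[OF n cop, of j]
  interpret f: group_hom ?D ?D ?f
    using f(1) by unfold_locales (auto simp: auto_def)
  have b: "?f (dih_b [^]\<^bsub>?D\<^esub> v) = (0, i * v mod int n)"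
  proof -
    have "?f (dih_b [^]\<^bsub>?D\<^esub> v) = (dih_b [^]\<^bsub>?D\<^esub> i) [^]\<^bsub>?D\<^esub> v"
      using f.hom_int_pow[OF dih_mem(2)[OF n]] f(3) by metis
    also have "\<dots> = dih_b [^]\<^bsub>?D\<^esub> (i * v)"
      using int_pow_pow[OF dih_mem(2)[OF n]] by simp
    finally show ?thesis by (simp add: dih_b_pow n)
  qed
  then show "?f (0, v mod int n) = (0, i * v mod int n)"
    by (simp add: dih_b_pow n)
  have "?f (dih_a \<otimes>\<^bsub>?D\<^esub> (dih_b [^]\<^bsub>?D\<^esub> v)) = ?f dih_a \<otimes>\<^bsub>?D\<^esub> ?f (dih_b [^]\<^bsub>?D\<^esub> v)"
    using dih_mem[OF n] by (intro f.hom_mult int_pow_closed) auto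
  then show "?f (1, v mod int n) = (1, (j + i * v) mod int n)"
    unfolding b f(2) dih_normal_form[OF n] by (simp add: mod_simps)
qed

section \<open>A tiling of an interval and the near-factorization it yields\<close>

text \<open>The blocks of length \<open>2 * m - 1\<close> centred at the first \<open>m\<close>
  positive multiples of \<open>2 * m - 1\<close> are adjacent; the first starts at \<open>m\<close>
  and the last ends at \<open>2 * m\<^sup>2 - 1\<close>.\<close>

lemma block_decomposition:
  fixes m t :: int
  assumes "m \<ge> 1"
  shows "t \<in> {m..<2 * m\<^sup>2} \<longleftrightarrow> (\<exists>i\<in>{1 - m..m - 1}. \<exists>j\<in>{1..m}. t = j * (2 * m - 1) + i)"
proof
  assume t: "t \<in> {m..<2 * m\<^sup>2}"
  \<comment> \<open>The shift by \<open>m - 1\<close> turns floor division into rounding to the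
    nearest multiple, so the remainder becomes centred at 0.\<close>
  define j where "j = (t + m - 1) div (2 * m - 1)"
  define i where "i = (t + m - 1) mod (2 * m - 1) - (m - 1)"
  have "t = j * (2 * m - 1) + i"
    unfolding i_def j_def using div_mult_mod_eq[of "t + m - 1" "2 * m - 1"] by linarith
  moreover have "i \<in> {1 - m..m - 1}"
    unfolding i_def using pos_mod_bound[of "2 * m - 1" "t + m - 1"]
      pos_mod_sign[of "2 * m - 1" "t + m - 1"] assms
    by (simp del: pos_mod_bound pos_mod_sign)
  moreover have "j \<ge> 1"
    unfolding j_def using t assms by (simp add: pos_imp_zdiv_pos_iff int_one_le_iff_zero_less)
  moreover have "j < m + 1"
  proof (rule ccontr)
    assume "\<not> j < m + 1"
    \<comment> \<open>Subtracting at most \<open>m - 1\<close> from this bound still leaves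
      \<open>t \<ge> 2 * m\<^sup>2\<close>.\<close>
    then have "(m + 1) * (2 * m - 1) \<le> j * (2 * m - 1)"
      using assms by (intro mult_right_mono) auto
    with calculation(1,2) t show False
      by (auto simp: algebra_simps power2_eq_square)
  qed
  ultimately show "\<exists>i\<in>{1 - m..m - 1}. \<exists>j\<in>{1..m}. t = j * (2 * m - 1) + i"
    by (intro bexI[of _ i] bexI[of _ j]) auto
next
  assume "\<exists>i\<in>{1 - m..m - 1}. \<exists>j\<in>{1..m}. t = j * (2 * m - 1) + i"
  then obtain i j where ij: "i \<in> {1 - m..m - 1}" "j \<in> {1..m}" "t = j * (2 * m - 1) + i"
    by blast
  have "1 * (2 * m - 1) \<le> j * (2 * m - 1)" "j * (2 * m - 1) \<le> m * (2 * m - 1)"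
    using ij assms by (auto intro!: mult_right_mono)
  with ij show "t \<in> {m..<2 * m\<^sup>2}"
    by (auto simp: algebra_simps power2_eq_square)
qed

text \<open>Index 0 absorbs the two isolated elements: it gives \<open>a\<close> among the
  reflections of \<open>A\<close> and \<open>e\<close> among the rotations of \<open>B\<close>. The
  product is then surjective by the tiling.\<close>

lemma dihedral_near_factorization:
  fixes m :: int and n :: nat
  assumes m: "m \<ge> 1" and n: "int n = 2 * m\<^sup>2"
  defines "A \<equiv> Pair 0 ` {1..m - 1} \<union> Pair 1 ` {0..m - 1}"
    and "B \<equiv> Pair 0 ` (\<lambda>j. j * (2 * m - 1)) ` {0..m} \<union> Pair 1 ` (\<lambda>j. j * (2 * m - 1)) ` {1..m}"
  shows "near_factorization (dihedral n) (A, B)"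
proof -
  let ?D = "dihedral n" and ?\<alpha> = "2 * m - 1"
  have n0: "n > 0" using m n by (cases n) auto
  have mn: "m < int n" using m n mult_right_mono[of 1 m m] by (simp add: power2_eq_square)
  \<comment> \<open>The gap \<open>m\<close> below \<open>n\<close> ensures that adding an exponent
    from \<open>A\<close>, at most \<open>m - 1\<close>, never wraps around modulo
    \<open>n\<close>.\<close>
  have j\<alpha>: "0 \<le> j * ?\<alpha> \<and> j * ?\<alpha> \<le> int n - m \<and> j * ?\<alpha> < int n" if "0 \<le> j" "j \<le> m" for j
    using that m n mult_right_mono[of j m ?\<alpha>] mult_nonneg_nonneg[of j ?\<alpha>]
    by (auto simp: algebra_simps power2_eq_square)
  have "card A = card (Pair (0::int) ` {1..m - 1}) + card (Pair (1::int) ` {0..m - 1})"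
    unfolding A_def by (rule card_Un_disjoint) auto
  then have "card A = nat (m - 1) + nat m"
    by (simp add: card_image inj_on_def)
  moreover have "card B = card (Pair (0::int) ` (\<lambda>j. j * ?\<alpha>) ` {0..m}) + card (Pair (1::int) ` (\<lambda>j. j * ?\<alpha>) ` {1..m})"
    unfolding B_def by (rule card_Un_disjoint) auto
  then have "card B = nat (m + 1) + nat m"
    using m by (simp add: card_image inj_on_def)
  \<comment> \<open>The count is \<open>(2m - 1)(2m + 1) = 4m^2 - 1 = 2n - 1\<close>.\<close>
  ultimately have "int (card A * card B) = int (order ?D - 1)"
    using m n n0 by (simp add: dih_order of_nat_diff algebra_simps power2_eq_square)
  then have card: "card A * card B = order ?D - 1" by linarith
  have sub: "A \<subseteq> carrier ?D" "B \<subseteq> carrier ?D"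
    using mn m j\<alpha> n0 by (auto simp: A_def B_def)
  have "A <#>\<^bsub>?D\<^esub> B = carrier ?D - {\<one>\<^bsub>?D\<^esub>}"
  proof
    show "A <#>\<^bsub>?D\<^esub> B \<subseteq> carrier ?D - {\<one>\<^bsub>?D\<^esub>}"
    proof
      fix x assume "x \<in> A <#>\<^bsub>?D\<^esub> B"
      then obtain u v where uv: "u \<in> A" "v \<in> B" and x_eq: "x = u \<otimes>\<^bsub>?D\<^esub> v"
        unfolding set_mult_def by blast
      have "\<exists>c' j. (c' = 0 \<or> c' = 1) \<and> 0 \<le> j \<and> j \<le> m \<and> (c' = 1 \<longrightarrow> 1 \<le> j) \<and> v = (c', j * ?\<alpha>)"
      proof -
        consider j where "j \<in> {0..m}" "v = (0, j * ?\<alpha>)" | j where "j \<in> {1..m}" "v = (1, j * ?\<alpha>)"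
          using uv(2) unfolding B_def by blast
        then show ?thesis
        proof cases
          case (1 j)
          then show ?thesis by (intro exI[of _ 0] exI[of _ j]) simp
        next
          case (2 j)
          then show ?thesis by (intro exI[of _ 1] exI[of _ j]) simp
        qed
      qed
      with uv(1) x_eq obtain c i c' j where ci: "(c, i) \<in> A" and c': "c' = 0 \<or> c' = 1"
        and j: "0 \<le> j" "j \<le> m" "c' = 1 \<Longrightarrow> 1 \<le> j"
        and x: "x = (c, i) \<otimes>\<^bsub>?D\<^esub> (c', j * ?\<alpha>)"
        by (metis surj_pair)
      have c: "c = 0 \<or> c = 1" and i: "0 \<le> i" "i \<le> m - 1" "c = 0 \<Longrightarrow> 1 \<le> i"
        using ci by (auto simp: A_def)
      \<comment> \<open>A reflection on the right negates \<open>i\<close>; since reflections in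
        \<open>B\<close> have \<open>j \<ge> 1\<close>, the exponent stays positive.\<close>
      have "1 \<le> j * ?\<alpha> - i" if "c' = 1"
      proof -
        have "1 * ?\<alpha> \<le> j * ?\<alpha>"
          using j(3)[OF that] m by (intro mult_right_mono) auto
        moreover have "i + 1 \<le> 1 * ?\<alpha>" using m i by simp
        ultimately show ?thesis by (simp only: le_diff_eq add.commute order_trans)
      qed
      then have minus: "(j * ?\<alpha> - i) mod int n = j * ?\<alpha> - i" "j * ?\<alpha> - i \<noteq> 0" if "c' = 1"
        using that j\<alpha>[OF j(1,2)] i m mn by (auto intro!: mod_pos_pos_trivial)
      have plus: "(i + j * ?\<alpha>) mod int n = i + j * ?\<alpha>" "c = 0 \<Longrightarrow> i + j * ?\<alpha> \<noteq> 0"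
        using j\<alpha>[OF j(1,2)] i by (auto intro!: mod_pos_pos_trivial)
      show "x \<in> carrier ?D - {\<one>\<^bsub>?D\<^esub>}"
        using c c' minus plus n0 unfolding x by auto
    qed
    show "carrier ?D - {\<one>\<^bsub>?D\<^esub>} \<subseteq> A <#>\<^bsub>?D\<^esub> B"
    proof
      fix x assume x: "x \<in> carrier ?D - {\<one>\<^bsub>?D\<^esub>}"
      have prod: "x \<in> A <#>\<^bsub>?D\<^esub> B" if "u \<in> A" "v \<in> B" "x = u \<otimes>\<^bsub>?D\<^esub> v" for u v
        using that unfolding set_mult_def by blast
      obtain c t where x_eq: "x = (c, t)" by (cases x)
      have c: "c = 0 \<or> c = 1" and t: "0 \<le> t" "t < int n" and ct: "c = 0 \<Longrightarrow> t \<noteq> 0"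
        using x by (auto simp: x_eq)
      show "x \<in> A <#>\<^bsub>?D\<^esub> B"
      proof (cases "t < m")
        case True
        \<comment> \<open>Below \<open>m\<close> the element lies in \<open>A\<close> itself and is
          multiplied by the identity, which is in \<open>B\<close>.\<close>
        then have "(c, t) \<in> A" using c t ct by (auto simp: A_def)
        moreover have "(0, 0) \<in> B" using m by (force simp: B_def)
        ultimately show ?thesis
          by (rule prod) (use c t in \<open>auto simp: x_eq\<close>)
      next
        case False
        then obtain i j where ij: "i \<in> {1 - m..m - 1}" "j \<in> {1..m}" and t_eq: "t = j * ?\<alpha> + i"
          using block_decomposition[of m t] t m n by auto
        have B: "(0, j * ?\<alpha>) \<in> B" "(1, j * ?\<alpha>) \<in> B" using ij by (auto simp: B_def)
        show ?thesis
        proof (cases "i > 0")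
          case True
          then have "(c, i) \<in> A" using ij c by (auto simp: A_def)
          then show ?thesis
            by (rule prod[OF _ B(1)]) (use c t in \<open>auto simp: x_eq t_eq algebra_simps\<close>)
        next
          case False
          show ?thesis
          \<comment> \<open>Here \<open>i \<le> 0\<close>, so a reflection from \<open>B\<close> is
            used to turn \<open>- i\<close> into \<open>i\<close>. This fails only for
            \<open>c = 1\<close>, \<open>i = 0\<close>, where the left factor would be the identity,
            absent from \<open>A\<close>; then \<open>a\<close> times a rotation serves.\<close>
          proof (cases "c = 0 \<or> i < 0")
            case True
            then have "(1 - c, - i) \<in> A" using False ij c by (auto simp: A_def)
            then show ?thesis
              by (rule prod[OF _ B(2)]) (use c t in \<open>auto simp: x_eq t_eq algebra_simps\<close>)
          next
            case False
            then have "i = 0" "c = 1" "(1, 0) \<in> A"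
              using c \<open>\<not> i > 0\<close> m by (auto simp: A_def)
            then show ?thesis
              by (intro prod[OF _ B(1), of "(1, 0)"]) (use t in \<open>auto simp: x_eq t_eq algebra_simps\<close>)
          qed
        qed
      qed
    qed
  qed
  with sub card n0 show ?thesis
    by (simp add: near_factorization_def dih_group)
qed

section \<open>The explicit equivalence by multiplication of exponents\<close>

theorem theorem2p4:
  fixes k n :: nat and \<alpha> d1 d2 a0 b0 s :: int
    and D :: "(int \<times> int) monoid" (structure) and a b :: "int \<times> int"
    and A B A' B' :: "(int \<times> int) set"
  assumes k: "k \<ge> 3"
    and n: "n = 2 ^ (2 * k - 1)"
    and \<alpha>: "\<alpha> = 2 ^ k - 1"
    and d1: "d1 = 2 ^ k + 3"
    and d2: "d2 = 2 ^ (k + 1) - 3"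
    and a0: "a0 = 2 ^ (k - 1) - 1"
    and b0: "b0 = 2 ^ (k - 1)"
    and s: "s = 2 ^ (k - 1) - 3"
    and D: "D = dihedral n"
    and a: "a = dih_a"
    and b: "b = dih_b"
    and A: "A = {b [^] i |i. i \<in> {1..a0}} \<union> {a \<otimes> b [^] i |i. i \<in> {1..a0}} \<union> {a}"
    and B: "B = {b [^] (i * \<alpha>) |i. i \<in> {1..b0}} \<union> {a \<otimes> b [^] (i * \<alpha>) |i. i \<in> {1..b0}} \<union> {\<one>}"
    and A': "A' = {b [^] (- s + i * d1) |i. i \<in> {0..a0 - 1}} \<union>
                  {a \<otimes> b [^] (- s + i * d1) |i. i \<in> {0..a0 - 1}} \<union> {a}"
    and B': "B' = {b [^] (- s + i * d2) |i. i \<in> {1..b0}} \<union>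
                  {a \<otimes> b [^] (- s + i * d2) |i. i \<in> {1..b0}} \<union> {\<one>}"
  shows "nf_equivalent D (A, B) (A', B') \<and>
         coprime (- d1) (int n) \<and>
         nf_map D (dih_aut n (- d1) 0) \<one> (A, B) = (A', B')"
proof -
  define m :: int where "m = 2 ^ (k - 1)"
  have km: "(2::int) ^ k = 2 * m"
    using k unfolding m_def by (cases k) auto
  have "2 * k - 1 = Suc ((k - 1) * 2)" using k by simp
  then have nm: "int n = 2 * m\<^sup>2"
    unfolding n m_def by (simp add: power_mult)
  have "(2::int) ^ 2 \<le> m"
    unfolding m_def using k by (intro power_increasing) auto
  then have m: "m \<ge> 4" by simp
  have params: "\<alpha> = 2 * m - 1" "d1 = 2 * m + 3" "d2 = 4 * m - 3" "a0 = m - 1" "b0 = m" "s = m - 3"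
    using km by (simp_all add: \<alpha> d1 d2 a0 b0 s m_def)
  have "4 * 4 \<le> m * m" using m by (intro mult_mono) auto
  then have n2: "n > 2" using nm by (simp add: power2_eq_square)
  \<comment> \<open>As \<open>n\<close> is a power of two, oddness gives coprimality.\<close>
  have "odd (- d1)" by (simp add: params)
  then have cop: "coprime (- d1) (int n)"
    by (simp add: n coprime_commute)
  interpret group D using n2 by (simp add: D dih_group)
  let ?f = "dih_aut n (- d1) 0" and ?r = "\<lambda>v. v mod int n"
  have f: "?f \<in> auto D" using dih_aut(1)[OF n2 cop] by (simp add: D)
  have f01: "?f (0, ?r v) = (0, ?r (- d1 * v))" "?f (1, ?r v) = (1, ?r (- d1 * v))" for v
    using dih_aut_apply[OF n2 cop, of 0 v] by simp_all
  have b_pow: "b [^] i = (0, ?r i)" and ab_pow: "a \<otimes> b [^] i = (1, ?r i)" for i :: int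
    unfolding a b D by (rule dih_b_pow[OF n2], rule dih_normal_form[OF n2])
  \<comment> \<open>Writing 0 as \<open>?r 0\<close> lets \<open>f01\<close> rewrite these elements
    too.\<close>
  have one: "\<one> = (0, ?r 0)" and a_eq: "a = (1, ?r 0)" by (simp_all add: D a dih_a_def)

  have A_eq: "A = Pair 0 ` ?r ` {1..m - 1} \<union> Pair 1 ` ?r ` {1..m - 1} \<union> {(1, ?r 0)}"
    and A'_eq: "A' = Pair 0 ` (\<lambda>i. ?r (- s + i * d1)) ` {0..m - 2} \<union>
        Pair 1 ` (\<lambda>i. ?r (- s + i * d1)) ` {0..m - 2} \<union> {(1, ?r 0)}"
    and B_eq: "B = Pair 0 ` (\<lambda>i. ?r (i * \<alpha>)) ` {1..m} \<union> Pair 1 ` (\<lambda>i. ?r (i * \<alpha>)) ` {1..m} \<union> {(0, ?r 0)}"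
    and B'_eq: "B' = Pair 0 ` (\<lambda>i. ?r (- s + i * d2)) ` {1..m} \<union>
        Pair 1 ` (\<lambda>i. ?r (- s + i * d2)) ` {1..m} \<union> {(0, ?r 0)}"
    unfolding A A' B B' ab_pow unfolding b_pow one a_eq params(4,5)
    by (simp_all only: Setcompr_eq_image image_image) simp_all

  have revA: "(\<lambda>i. ?r (- d1 * i)) ` {1..m - 1} = (\<lambda>i. ?r (- s + i * d1)) ` {0..m - 2}"
  proof -
    \<comment> \<open>The exact identity is \<open>(m - 1) d1 = s + n\<close>; the reversal of the
      index is \<open>i\<close> to \<open>m - 1 - i\<close>.\<close>
    have "- s + (m - 1 - i) * d1 = - d1 * i + 1 * int n" for i
      by (simp add: params nm algebra_simps power2_eq_square)
    then have "?r (- d1 * i) = ?r (- s + (m - 1 - i) * d1)" for i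
      by (metis mod_mult_self1)
    then have "(\<lambda>i. ?r (- d1 * i)) ` {1..m - 1} = (\<lambda>i. ?r (- s + i * d1)) ` (\<lambda>i. m - 1 - i) ` {1..m - 1}"
      by (simp only: image_image)
    then show ?thesis by simp
  qed
  have revB: "(\<lambda>i. ?r (- d1 * (i * \<alpha>))) ` {1..m} = (\<lambda>i. ?r (- s + i * d2)) ` {1..m}"
  proof -
    \<comment> \<open>Exactly, \<open>(m + 1) d2 = s + 2n\<close> and
      \<open>\<alpha> d1 = d2 + 2n\<close>, which contribute the multiples 2 and
      \<open>2 * i\<close> of \<open>n\<close>.\<close>
    have "- s + (m + 1 - i) * d2 = - d1 * (i * \<alpha>) + (2 + 2 * i) * int n" for i
      by (simp add: params nm algebra_simps power2_eq_square)
    then have "?r (- d1 * (i * \<alpha>)) = ?r (- s + (m + 1 - i) * d2)" for i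
      by (metis mod_mult_self1)
    then have "(\<lambda>i. ?r (- d1 * (i * \<alpha>))) ` {1..m} = (\<lambda>i. ?r (- s + i * d2)) ` (\<lambda>i. m + 1 - i) ` {1..m}"
      by (simp only: image_image)
    then show ?thesis by simp
  qed
  have fA: "?f ` A = A'"
    unfolding A_eq A'_eq revA[symmetric] by (simp only: image_Un image_image image_insert image_empty f01) simp
  have fB: "?f ` B = B'"
    unfolding B_eq B'_eq revB[symmetric] by (simp only: image_Un image_image image_insert image_empty f01) simp

  have "m - 1 < int n"
    unfolding nm power2_eq_square using m mult_right_mono[of 1 m m] by linarith
  then have rA: "?r ` {1..m - 1} = {1..m - 1}" by (force simp: image_iff)
  have "insert 0 {1..m - 1} = {0..m - 1}" using m by auto
  then have A_std: "A = Pair 0 ` {1..m - 1} \<union> Pair 1 ` {0..m - 1}"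
    unfolding A_eq rA by auto
  have "?r (i * \<alpha>) = i * (2 * m - 1)" if "i \<in> {1..m}" for i
    using that m nm mult_right_mono[of i m "2 * m - 1"]
    by (auto simp: params algebra_simps power2_eq_square intro!: mod_pos_pos_trivial)
  then have rB: "(\<lambda>i. ?r (i * \<alpha>)) ` {1..m} = (\<lambda>i. i * (2 * m - 1)) ` {1..m}"
    by (intro image_cong) auto
  have "{0..m} = insert 0 {1..m}" using m by auto
  then have B_std: "B = Pair 0 ` (\<lambda>j. j * (2 * m - 1)) ` {0..m} \<union> Pair 1 ` (\<lambda>j. j * (2 * m - 1)) ` {1..m}"
    unfolding B_eq rB by auto
  have nf: "near_factorization D (A, B)"
    unfolding D A_std B_std using dihedral_near_factorization[of m n] m nm by simp

  have "A' \<subseteq> carrier D" "B' \<subseteq> carrier D"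
    using n2 by (auto simp: A'_eq B'_eq D)
  then have map: "nf_map D ?f \<one> (A, B) = (A', B')"
    using nf_map_one[of D ?f A B] group_axioms fA fB by simp
  \<comment> \<open>The property is transported along the automorphism instead of being counted
    again.\<close>
  moreover have "near_factorization D (A', B')"
    using near_factorization_nf_map[OF nf f one_closed] map by simp
  ultimately show ?thesis
    using nf f cop one_closed unfolding nf_equivalent_def by blast
qed

end
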